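(* Let $S$ be a bounded 4-CSP over $X=\{x_1,\dots,x_n\}$, with solution domain $D_s$ and minimum weight hypergraph $H^s_m$. Then $D_s\neq\emptyset$ if and only if all simple hypercycles of $H^s_m$ are positive.
   Context: $\mathbb{T}$ is $\mathbb{R}$ or $\mathbb{Q}$, $\overline{\mathbb{T}}=\mathbb{T}\cup\{+\infty,-\infty\}$. $X=\{x_1,\dots,x_n\}$ is a set of variables with values in $\mathbb{T}$, $x_0$ is a special variable always equal to $0$, and $X^0=X\cup\{x_0\}$. $e_1,\dots,e_n$ is the standard basis of $\mathbb{T}^n$ and $e_0$ is the zero vector. Canonical 4-constraints: $4\text{-}\Phi(X^0)$ is the set of inequalities $c_{ijpq}$: $(x_i-x_j)-(x_p-x_q)\le m_{ijpq}$ with $i,j,p,q\in\{0,\dots,n\}$ (repetitions allowed) and $m_{ijpq}\in\mathbb{T}$. The normal vector is $F_v(c_{ijpq})=e_i-e_j-e_p+e_q$, the bound is $F_b(c_{ijpq})=m_{ijpq}$, and the complement is $\overline{c_{ijpq}}=c_{jiqp}$, i.e. $(x_j-x_i)-(x_q-x_p)\le m_{jiqp}$, so $F_v(\overline c)=-F_v(c)$ (only the normal vector of $\overline c$ is used below). A 4-CSP $S$ over $X$ is a finite conjunction of canonical 4-constraints over $X^0$; $C_s$ is the set of these constraints. $D_s$ is the set of valuations $\nu$ (assigning $\nu_i\in\mathbb{T}$ to $x_i$, with $\nu_0=0$) satisfying all constraints of $C_s$. $S$ is bounded if there is $w\in\mathbb{T}$ such that every $\nu\in D_s$ satisfies $-w<\nu_i<w$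 for all $i$. Put $F^s_b(c)=F_b(c)$ if $c\in C_s$ and $F^s_b(c)=+\infty$ otherwise. A family $f=(V_i)_{i\in[1,r]}$ of distinct non-empty (i.e. nonzero) vectors of $\mathbb{T}^n$ is positively dependent if there are $\lambda_i\in\mathbb{N}^{>0}$ with $\sum_{i=1}^r\lambda_iV_i=e_0$, and positively independent otherwise. A positively dependent family is simple if every proper (nonempty) subfamily is positively independent. A set $C=\{c_1,\dots,c_r\}$ of distinct constraints generates a hypercycle (resp. simple hypercycle) if $(F_v(c_i))_{i\in[1,r]}$ is positively dependent (resp. simple positively dependent); the hypercycle is recorded with its coefficients as $(C,(\alpha_i))$, where $\alpha_i\in\mathbb{N}^{>0}$ and $\sum\alpha_iF_v(c_i)=e_0$. For $c\in 4\text{-}\Phi(X^0)$, the set of hyperpaths of $c$ is $$HPath(c)=\Big\{(P,(\tfrac{\lambda_i}{\lambda})_{i\in[1,r]})\ \Big|\ P=\{c_1,\dots,c_r\}\subseteq 4\text{-}\Phi(X^0),\ \lambda,\lambda_i\in\mathbb{N}^{>0},\ F_v(\overline c)+\sum_{i=1}^r\tfrac{\lambda_i}{\lambda}F_v(c_i)=e_0\Big\},$$ where the normal vectors of the elements of $P$ are distinct and nonzero. The weight of a hyperpath is $F^s_b((P,(\lambda_i)))=\sum\lambda_iF^s_b(c_i)$. Define $F^s_{bm}(c)=\min\{F^s_b((P,(\lambda_k))) : (P,(\lambda_k))\in HPath(c)\}$, understood as $-\infty$ if this set has no lower bound. The hypergraph $H^s$ associated with $S$ has node set $X^0$, hyperarcs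 given by the constraints, and weight function $F^s_b$. The minimum weight hypergraph $H^s_m$ is the same hypergraph with weight function $w_m(c)=F^s_{bm}(c)$ if $c\in C_s$ and $w_m(c)=+\infty$ otherwise. A hypercycle $(C,(\alpha_i))$ with $C=\{c_1,c_2,\dots\}$ is positive in $H^s_m$ if $\sum\alpha_iw_m(c_i)\ge0$.
   Formalization: Added: every constraint of S with zero normal vector, i.e. of the form 0 ≤ m, has m ≥ 0; otherwise C_s = {0 ≤ −1} gives D_s = ∅ (so S is bounded), yet all simple hypercycles have weight +∞ and are positive. *)

theory Defs
  imports "HOL-Analysis.Finite_Cartesian_Product" "HOL-Library.Extended"
begin

text \<open>
  The variables \<open>x_1, \<dots>, x_n\<close> are indexed by a finite type \<open>'n\<close> with \<open>n = CARD('n)\<close>; the special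
  variable \<open>x_0\<close> is \<open>None\<close>, so that \<open>'n option\<close> is the set \<open>X\<^sup>0\<close>. The scalar type \<open>'a\<close> stands for
  the reals or the rationals, and \<open>'a extended\<close> adds the two infinities to it.
\<close>

fun basis_vec :: "'n::finite option \<Rightarrow> ('a::linordered_field)^'n" where
  "basis_vec None = 0"
| "basis_vec (Some i) = axis i 1"

fun valuation_at :: "('a::linordered_field)^'n::finite \<Rightarrow> 'n option \<Rightarrow> 'a" where
  "valuation_at \<nu> None = 0"
| "valuation_at \<nu> (Some i) = \<nu> $ i"


subsection \<open>Canonical 4-constraints\<close>

text \<open>
  \<open>Constr i j p q m\<close> is the inequality \<open>(x_i - x_j) - (x_p - x_q) \<le> m\<close>, as a syntactic object.
  The whole type is the set \<open>4-\<Phi>(X\<^sup>0)\<close>.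
\<close>

datatype ('a, 'n) constraint4 =
  Constr "'n option" "'n option" "'n option" "'n option" (bound: 'a)

fun normal :: "('a::linordered_field, 'n::finite) constraint4 \<Rightarrow> 'a^'n" where
  "normal (Constr i j p q m) = basis_vec i - basis_vec j - basis_vec p + basis_vec q"

text \<open>
  The normal vector of the complement. The complement of \<open>c_ijpq\<close> is \<open>c_jiqp\<close> with some bound
  \<open>m_jiqp\<close>; that bound does not enter the normal vector, so any value serves in its place.
\<close>

fun complement_normal :: "('a::linordered_field, 'n::finite) constraint4 \<Rightarrow> 'a^'n" where
  "complement_normal (Constr i j p q m) = normal (Constr j i q p m)"

fun satisfies :: "('a::linordered_field)^'n::finite \<Rightarrow> ('a, 'n) constraint4 \<Rightarrow> bool" where
  "satisfies \<nu> (Constr i j p q m) \<longleftrightarrow>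
     (valuation_at \<nu> i - valuation_at \<nu> j) - (valuation_at \<nu> p - valuation_at \<nu> q) \<le> m"


subsection \<open>4-CSPs\<close>

text \<open>A 4-CSP is represented by its finite set of constraints.\<close>

definition solutions :: "('a::linordered_field, 'n::finite) constraint4 set \<Rightarrow> ('a^'n) set" where
  "solutions S = {\<nu>. \<forall>c\<in>S. satisfies \<nu> c}"

definition bounded_csp :: "('a::linordered_field, 'n::finite) constraint4 set \<Rightarrow> bool" where
  "bounded_csp S \<longleftrightarrow> (\<exists>w. \<forall>\<nu>\<in>solutions S. \<forall>i. - w < \<nu> $ i \<and> \<nu> $ i < w)"

definition weight :: "('a::linordered_field, 'n::finite) constraint4 set \<Rightarrow>
    ('a, 'n) constraint4 \<Rightarrow> 'a extended" where
  "weight S c = (if c \<in> S then Fin (bound c) else \<infinity>)"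


subsection \<open>Positive dependence and hypercycles\<close>

text \<open>The families \<open>(V_i)\<close>, \<open>i \<in> I\<close>, are non-empty families of distinct nonzero vectors.\<close>

definition pos_dep_coeffs ::
    "'i set \<Rightarrow> ('i \<Rightarrow> ('a::linordered_field)^'n::finite) \<Rightarrow> ('i \<Rightarrow> nat) \<Rightarrow> bool" where
  "pos_dep_coeffs I V \<alpha> \<longleftrightarrow> (\<forall>i\<in>I. 0 < \<alpha> i) \<and> (\<Sum>i\<in>I. of_nat (\<alpha> i) *s V i) = 0"

definition positively_dependent ::
    "'i set \<Rightarrow> ('i \<Rightarrow> ('a::linordered_field)^'n::finite) \<Rightarrow> bool" where
  "positively_dependent I V \<longleftrightarrow>
     finite I \<and> I \<noteq> {} \<and> inj_on V I \<and> (\<forall>i\<in>I. V i \<noteq> 0) \<and> (\<exists>\<alpha>. pos_dep_coeffs I V \<alpha>)"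

definition simple_positively_dependent ::
    "'i set \<Rightarrow> ('i \<Rightarrow> ('a::linordered_field)^'n::finite) \<Rightarrow> bool" where
  "simple_positively_dependent I V \<longleftrightarrow>
     positively_dependent I V \<and> (\<forall>J. J \<subset> I \<and> J \<noteq> {} \<longrightarrow> \<not> positively_dependent J V)"

text \<open>
  A constraint with normal vector zero reads \<open>0 \<le> m\<close> and lies on no hypercycle, so a CSP that contains
  such a constraint with \<open>m < 0\<close> is unsatisfiable without the hypercycles showing it.
\<close>

definition simple_hypercycle ::
    "('a::linordered_field, 'n::finite) constraint4 set \<Rightarrow> (('a, 'n) constraint4 \<Rightarrow> nat) \<Rightarrow> bool" where
  "simple_hypercycle C \<alpha> \<longleftrightarrow> simple_positively_dependent C normal \<and> pos_dep_coeffs C normal \<alpha>"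


subsection \<open>Hyperpaths and the minimum weight hypergraph\<close>

text \<open>
  The second component of a hyperpath maps \<open>c_i\<close> to \<open>\<lambda>_i / \<lambda>\<close>; only its values on the first
  component are relevant.
\<close>

definition hyperpaths :: "('a::linordered_field, 'n::finite) constraint4 \<Rightarrow>
    (('a, 'n) constraint4 set \<times> (('a, 'n) constraint4 \<Rightarrow> 'a)) set" where
  "hyperpaths c = {(P, \<mu>).
     finite P \<and> P \<noteq> {} \<and> inj_on normal P \<and> (\<forall>d\<in>P. normal d \<noteq> 0) \<and>
     (\<exists>(l::nat) (k::('a, 'n) constraint4 \<Rightarrow> nat). 0 < l \<and>
        (\<forall>d\<in>P. 0 < k d \<and> \<mu> d = of_nat (k d) / of_nat l)) \<and>
     complement_normal c + (\<Sum>d\<in>P. \<mu> d *s normal d) = 0}"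

text \<open>
  \<open>map_extended ((*) a)\<close> is multiplication by a positive scalar \<open>a\<close>, fixing both infinities.
\<close>

definition weighted_sum :: "(('a::linordered_field, 'n::finite) constraint4 \<Rightarrow> 'a extended) \<Rightarrow>
    ('a, 'n) constraint4 set \<times> (('a, 'n) constraint4 \<Rightarrow> 'a) \<Rightarrow> 'a extended" where
  "weighted_sum w = (\<lambda>(P, \<mu>). \<Sum>d\<in>P. map_extended ((*) (\<mu> d)) (w d))"

text \<open>
  The value \<open>-\<infinity>\<close> of the minimum weight is used when no scalar bounds the hyperpath weights from
  below. If \<open>normal c = 0\<close>, the weights may be bounded below without having a minimum, and then
  \<open>LEAST\<close> is unspecified; such constraints lie on no hypercycle.
\<close>

definition min_weight :: "('a::linordered_field, 'n::finite) constraint4 set \<Rightarrow>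
    ('a, 'n) constraint4 \<Rightarrow> 'a extended" where
  "min_weight S c =
     (let W = weighted_sum (weight S) ` hyperpaths c
      in if \<exists>m. \<forall>x\<in>W. Fin m \<le> x then (LEAST x. x \<in> W) else -\<infinity>)"

text \<open>
  The nodes and hyperarcs of the minimum weight hypergraph are given by the types, so it is
  represented by its weight function.
\<close>

definition min_hypergraph :: "('a::linordered_field, 'n::finite) constraint4 set \<Rightarrow>
    ('a, 'n) constraint4 \<Rightarrow> 'a extended" where
  "min_hypergraph S c = (if c \<in> S then min_weight S c else \<infinity>)"

definition positive_hypercycle :: "(('a::linordered_field, 'n::finite) constraint4 \<Rightarrow> 'a extended) \<Rightarrow>
    ('a, 'n) constraint4 set \<Rightarrow> (('a, 'n) constraint4 \<Rightarrow> nat) \<Rightarrow> bool" where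
  "positive_hypercycle w C \<alpha> \<longleftrightarrow> 0 \<le> weighted_sum w (C, \<lambda>d. of_nat (\<alpha> d))"

end

theory Submission
  imports Defs "HOL-Library.Product_Plus"
begin

text \<open>
  A solution \<open>\<nu>\<close> bounds every hyperpath weight of \<open>c\<close> below by the scalar product of \<open>\<nu>\<close> with the
  normal of \<open>c\<close>, and these products cancel along a hypercycle. Conversely, if there is no solution,
  Fourier-Motzkin elimination over the integral normals produces natural multipliers that add the
  constraints up to \<open>0 \<le> \<beta>\<close> with \<open>\<beta> < 0\<close>; a combination of this kind of minimal support is a simple
  hypercycle of negative weight, and passing to minimum weights can only decrease the weight. In both
  directions the minimum weight, once bounded below, has to be attained: by a Caratheodory argument
  it suffices to consider the finitely many supports that carry a single combination.
\<close>

section \<open>Farkas' lemma with natural multipliers\<close>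

text \<open>Any commutative ring is allowed for the entries, so that real and rational vectors are
  treated alike.\<close>

definition dot :: "('a::comm_ring_1)^'n::finite \<Rightarrow> 'a^'n \<Rightarrow> 'a" where
  "dot a x = (\<Sum>i\<in>UNIV. a $ i * x $ i)"

lemma dot_add_left: "dot (a + b) x = dot a x + dot b x"
  by (simp add: dot_def distrib_right sum.distrib)

lemma dot_diff_left: "dot (a - b) x = dot a x - dot b x"
  by (simp add: dot_def left_diff_distrib sum_subtractf)

lemma dot_scale_left: "dot (c *s a) x = c * dot a x"
  by (simp add: dot_def sum_distrib_left mult.assoc)

lemma dot_zero_left [simp]: "dot 0 x = 0"
  by (simp add: dot_def)

lemma dot_sum_left: "dot (\<Sum>d\<in>A. f d) x = (\<Sum>d\<in>A. dot (f d) x)"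
  by (induction A rule: infinite_finite_induct) (auto simp: dot_add_left)

lemma dot_axis_left: "dot (axis i 1) x = x $ i"
  by (simp add: dot_def axis_def if_distrib[of "\<lambda>c. c * _"] cong: if_cong)

lemma dot_axis_add_right: "dot a (x + axis i c) = dot a x + a $ i * c"
  by (simp add: dot_def axis_def if_distrib[of "(*) _"] distrib_left sum.distrib cong: if_cong)

text \<open>The additive semigroup generated by \<open>T\<close>: nonempty finite sums with
  repetition. Multipliers are thus natural numbers from the start, as the coefficients of a
  hypercycle must be.\<close>

inductive_set nat_cone :: "'v::ab_semigroup_add set \<Rightarrow> 'v set" for T where
  base: "t \<in> T \<Longrightarrow> t \<in> nat_cone T"
| add: "s \<in> nat_cone T \<Longrightarrow> t \<in> nat_cone T \<Longrightarrow> s + t \<in> nat_cone T"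

lemma nat_cone_subset:
  assumes "T' \<subseteq> nat_cone T"
  shows "nat_cone T' \<subseteq> nat_cone T"
proof
  fix t assume "t \<in> nat_cone T'"
  then show "t \<in> nat_cone T"
    using assms by induction (auto intro: nat_cone.add)
qed

text \<open>A positive integer of the field is \<open>of_nat (Suc n)\<close> for some
  \<open>n\<close>, so scaling by it is repeated addition. The count starts at \<open>Suc n\<close>
  because the empty sum is not in the cone.\<close>

lemma nat_cone_scale:
  fixes T :: "((('a::linordered_field)^'n::finite) \<times> 'a) set"
  assumes "(a, b) \<in> nat_cone T" and "c \<in> \<int>" and "0 < c"
  shows "(c *s a, c * b) \<in> nat_cone T"
proof -
  have "(of_nat (Suc n) *s a, of_nat (Suc n) * b) \<in> nat_cone T" for n
  proof (induction n)
    case (Suc n)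
    from nat_cone.add[OF this assms(1)] show ?case
      unfolding of_nat_Suc[of "Suc n"] vector_sadd_rdistrib distrib_right
      by (simp add: add.commute del: of_nat_Suc)
  qed (use assms(1) in simp)
  moreover obtain n where "c = of_nat (Suc n)"
  proof -
    obtain z :: int where "c = of_int z" using assms(2) by (auto elim: Ints_cases)
    moreover from this have "z > 0" using assms(3) by simp
    moreover from this have "z = int (Suc (nat (z - 1)))" by simp
    ultimately show thesis using that by (metis of_int_of_nat_eq)
  qed
  ultimately show ?thesis by simp
qed

section \<open>Fourier-Motzkin elimination\<close>

text \<open>In the elimination \<open>A\<close> collects the lower and \<open>B\<close> the upper
  bounds for one coordinate. Either set may be empty, hence the choice between \<open>Max A\<close>,
  \<open>Min B\<close> and an arbitrary value.\<close>

lemma finite_separator: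
  fixes A B :: "'a::linordered_field set"
  assumes "finite A" and "finite B" and "\<And>a b. a \<in> A \<Longrightarrow> b \<in> B \<Longrightarrow> a \<le> b"
  shows "\<exists>c. (\<forall>a\<in>A. a \<le> c) \<and> (\<forall>b\<in>B. c \<le> b)"
proof (cases "A = {}")
  case True
  then show ?thesis
    using assms(2) by (cases "B = {}") (auto intro!: exI[of _ "Min B"])
next
  case False
  then show ?thesis
    using assms by (intro exI[of _ "Max A"]) (auto intro: Max.boundedI)
qed

text \<open>Induction on a set \<open>V\<close> of coordinates outside which all normals vanish.
  Eliminating \<open>v\<close> from an unsolvable system leaves an unsolvable one whose rows lie in
  the cone of the old rows. Integral entries are what makes this work with natural multipliers: the
  multipliers are entries of other rows.\<close>

theorem integral_farkas:
  fixes T :: "((('a::linordered_field)^'n::finite) \<times> 'a) set"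
  assumes "finite T"
    and "\<And>a b i. (a, b) \<in> T \<Longrightarrow> a $ i \<in> \<int>"
    and "\<nexists>x. \<forall>(a, b)\<in>T. dot a x \<le> b"
  shows "\<exists>\<beta><0. (0, \<beta>) \<in> nat_cone T"
proof -
  have "\<exists>\<beta><0. (0, \<beta>) \<in> nat_cone T"
    if "finite V" and "finite T"
      and "\<And>a b i. (a, b) \<in> T \<Longrightarrow> a $ i \<in> \<int> \<and> (i \<notin> V \<longrightarrow> a $ i = 0)"
      and "\<nexists>x. \<forall>(a, b)\<in>T. dot a x \<le> b"
    for V and T :: "(('a^'n) \<times> 'a) set"
    using that
  proof (induction V arbitrary: T rule: finite_induct)
    case empty
    \<comment> \<open>All normals are 0 here, so a row violated at the origin reads
      \<open>0 \<le> b\<close> with \<open>b < 0\<close> and is itself the certificate.\<close>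
    from empty.prems(3) obtain a b where ab: "(a, b) \<in> T" "\<not> dot a 0 \<le> b"
      by fast
    have "a = 0" using empty.prems(2)[OF ab(1)] by (simp add: vec_eq_iff)
    then show ?case using ab by (intro exI[of _ b]) (auto intro: nat_cone.base)
  next
    case (insert v V)
    define pos where "pos = {t \<in> T. 0 < fst t $ v}"
    define neg where "neg = {t \<in> T. fst t $ v < 0}"
    \<comment> \<open>For \<open>s\<close> in \<open>pos\<close> and \<open>t\<close> in
      \<open>neg\<close>, each row is multiplied by the absolute value of the other row's entry at
      \<open>v\<close>. Both factors are positive integers, and the entries at \<open>v\<close>
      cancel.\<close>
    define comb where "comb = (\<lambda>(s :: ('a^'n) \<times> 'a, t :: ('a^'n) \<times> 'a).
      ((- fst t $ v) *s fst s + (fst s $ v) *s fst t,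
       (- fst t $ v) * snd s + (fst s $ v) * snd t))"
    define T' where "T' = {t \<in> T. fst t $ v = 0} \<union> comb ` (pos \<times> neg)"
    have fin: "finite pos" "finite neg" "finite T'"
      using insert.prems(1) by (auto simp: pos_def neg_def T'_def)
    have integral: "fst t $ i \<in> \<int>" and supp: "i \<notin> insert v V \<Longrightarrow> fst t $ i = 0"
      if "t \<in> T" for t i
      using insert.prems(2)[of "fst t" "snd t" i] that by auto
    have "t \<in> nat_cone T" if t: "t \<in> T'" for t
    proof (cases "t \<in> T")
      case False
      then obtain p q where pq: "p \<in> pos" "q \<in> neg" "t = comb (p, q)"
        using t by (auto simp: T'_def)
      have "((- fst q $ v) *s fst p, (- fst q $ v) * snd p) \<in> nat_cone T"
        using pq integral by (intro nat_cone_scale) (auto simp: pos_def neg_def intro: nat_cone.base)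
      moreover have "((fst p $ v) *s fst q, (fst p $ v) * snd q) \<in> nat_cone T"
        using pq integral by (intro nat_cone_scale) (auto simp: pos_def neg_def intro: nat_cone.base)
      ultimately show ?thesis
        using nat_cone.add pq(3) by (fastforce simp: comb_def)
    qed (rule nat_cone.base)
    then have sub: "T' \<subseteq> nat_cone T" by blast
    have "a $ i \<in> \<int> \<and> (i \<notin> V \<longrightarrow> a $ i = 0)" if ab: "(a, b) \<in> T'" for a b i
    proof (cases "(a, b) \<in> T \<and> a $ v = 0")
      case True
      then show ?thesis using integral[of "(a, b)" i] supp[of "(a, b)" i] by (cases "i = v") auto
    next
      case False
      then obtain p q where pq: "p \<in> pos" "q \<in> neg" "(a, b) = comb (p, q)"
        using ab by (auto simp: T'_def)
      then have T: "p \<in> T" "q \<in> T" by (auto simp: pos_def neg_def)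
      have a: "a $ i = - (fst q $ v) * fst p $ i + fst p $ v * fst q $ i"
        using pq(3) by (simp add: comb_def)
      show ?thesis
      proof
        show "a $ i \<in> \<int>" unfolding a using T integral by (intro Ints_add Ints_mult Ints_minus)
        show "i \<notin> V \<longrightarrow> a $ i = 0" unfolding a using T supp by (cases "i = v") auto
      qed
    qed
    moreover have "\<nexists>x. \<forall>(a, b)\<in>T'. dot a x \<le> b"
    proof
      assume "\<exists>x. \<forall>(a, b)\<in>T'. dot a x \<le> b"
      then obtain x where x: "\<And>t. t \<in> T' \<Longrightarrow> dot (fst t) x \<le> snd t" by force
      \<comment> \<open>\<open>r t\<close> is the shift of coordinate \<open>v\<close> of
        \<open>x\<close> at which row \<open>t\<close> becomes an equality: a lower bound on the
        shift for rows in \<open>neg\<close>, an upper bound for rows in \<open>pos\<close>.\<close>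
      define r where "r = (\<lambda>t :: ('a^'n) \<times> 'a. (snd t - dot (fst t) x) / fst t $ v)"
      have "\<exists>c. (\<forall>a\<in>r ` neg. a \<le> c) \<and> (\<forall>b\<in>r ` pos. c \<le> b)"
      proof (rule finite_separator)
        fix a b assume "a \<in> r ` neg" "b \<in> r ` pos"
        then obtain p q where pq: "p \<in> pos" "q \<in> neg" "a = r q" "b = r p" by auto
        then have "comb (p, q) \<in> T'" by (auto simp: T'_def)
        \<comment> \<open>Up to positive factors, the combined row states that the lower bound given
          by \<open>q\<close> does not exceed the upper bound given by \<open>p\<close>.\<close>
        from x[OF this] have
          "fst p $ v * (dot (fst q) x - snd q) \<le> - fst q $ v * (snd p - dot (fst p) x)"
          by (simp add: comb_def dot_add_left dot_diff_left dot_scale_left algebra_simps)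
        moreover have sgn: "0 < fst p $ v" "fst q $ v < 0" using pq by (auto simp: pos_def neg_def)
        moreover have "snd p - dot (fst p) x = b * fst p $ v" "snd q - dot (fst q) x = a * fst q $ v"
          using sgn pq by (auto simp: r_def)
        ultimately have "(fst p $ v * - fst q $ v) * a \<le> (fst p $ v * - fst q $ v) * b"
          by (simp add: algebra_simps)
        then show "a \<le> b" using sgn by (simp add: mult_le_cancel_left_pos mult_pos_neg)
      qed (use fin in auto)
      then obtain c where c: "\<And>q. q \<in> neg \<Longrightarrow> r q \<le> c" "\<And>p. p \<in> pos \<Longrightarrow> c \<le> r p" by auto
      have "dot (fst t) (x + axis v c) \<le> snd t" if "t \<in> T" for t
      proof (cases "fst t $ v" "0 :: 'a" rule: linorder_cases)
        case less
        then show ?thesis using c(1)[of t] that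
          by (simp add: neg_def r_def dot_axis_add_right field_simps)
      next
        case equal
        then show ?thesis using x[of t] that by (simp add: T'_def dot_axis_add_right)
      next
        case greater
        then show ?thesis using c(2)[of t] that
          by (simp add: pos_def r_def dot_axis_add_right field_simps)
      qed
      then have "\<forall>(a, b)\<in>T. dot a (x + axis v c) \<le> b" by fastforce
      with insert.prems(3) show False by blast
    qed
    ultimately have "\<exists>\<beta><0. (0, \<beta>) \<in> nat_cone T'"
      by (rule insert.IH[OF fin(3)])
    then show ?case using nat_cone_subset[OF sub] by blast
  qed
  from this[of UNIV T] show ?thesis using assms by auto
qed

text \<open>\<open>\<alpha>\<close> counts how often each index is used. A generator that arises
  from several indices is attributed to one of them.\<close>

lemma nat_cone_image_coeffs:
  fixes V :: "'i \<Rightarrow> ('a::linordered_field)^'n::finite" and w :: "'i \<Rightarrow> 'a"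
  assumes "finite S" and "t \<in> nat_cone ((\<lambda>c. (V c, w c)) ` S)"
  shows "\<exists>\<alpha> :: 'i \<Rightarrow> nat. t = (\<Sum>c\<in>S. of_nat (\<alpha> c) *s V c, \<Sum>c\<in>S. of_nat (\<alpha> c) * w c)"
  using assms(2)
proof induction
  case (base t)
  then obtain d where "d \<in> S" "t = (V d, w d)" by auto
  moreover have "(\<Sum>c\<in>S. of_nat (if c = d then 1 else 0) *s V c) = V d"
    using \<open>d \<in> S\<close> assms(1) by (subst sum.mono_neutral_cong_right[of S "{d}" _ V]) auto
  moreover have "(\<Sum>c\<in>S. of_nat (if c = d then 1 else 0) * w c) = w d"
    using \<open>d \<in> S\<close> assms(1) by (subst sum.mono_neutral_cong_right[of S "{d}" _ w]) auto
  ultimately show ?case by (intro exI[of _ "\<lambda>c. if c = d then 1 else 0"]) simp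
next
  case (add s t)
  then obtain \<alpha> \<alpha>' :: "'i \<Rightarrow> nat" where
    "s = (\<Sum>c\<in>S. of_nat (\<alpha> c) *s V c, \<Sum>c\<in>S. of_nat (\<alpha> c) * w c)"
    "t = (\<Sum>c\<in>S. of_nat (\<alpha>' c) *s V c, \<Sum>c\<in>S. of_nat (\<alpha>' c) * w c)" by blast
  then show ?case
    by (intro exI[of _ "\<lambda>c. \<alpha> c + \<alpha>' c"])
      (simp add: vector_sadd_rdistrib distrib_right sum.distrib)
qed


section \<open>Positive rational combinations\<close>

text \<open>Common form of hyperpaths, with \<open>v\<close> a normal vector, and of hypercycles up
  to a common denominator, with \<open>v = 0\<close>. Rational coefficients, unlike natural ones,
  can be moved along a dependency by a rational step.\<close>

definition pos_rat_comb ::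
    "('i \<Rightarrow> ('a::linordered_field)^'n::finite) \<Rightarrow> 'a^'n \<Rightarrow> 'i set \<Rightarrow> ('i \<Rightarrow> 'a) \<Rightarrow> bool" where
  "pos_rat_comb V v P \<mu> \<longleftrightarrow>
     finite P \<and> (\<forall>d\<in>P. 0 < \<mu> d \<and> \<mu> d \<in> \<rat>) \<and> (\<Sum>d\<in>P. \<mu> d *s V d) = v"

lemma pos_rat_as_quotient:
  fixes x :: "'a::linordered_field"
  assumes "0 < x" and "x \<in> \<rat>"
  shows "\<exists>a b :: nat. 0 < a \<and> 0 < b \<and> x = of_nat a / of_nat b"
proof -
  obtain a b :: int where ab: "b > 0" "x = of_int a / of_int b"
    using assms(2) by (auto elim: Rats_cases')
  then have "a > 0" using assms(1) by (simp add: zero_less_divide_iff)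
  then show ?thesis using ab by (intro exI[of _ "nat a"] exI[of _ "nat b"]) simp
qed

lemma common_denominator:
  fixes \<mu> :: "'i \<Rightarrow> 'a::linordered_field"
  assumes "finite P" and "\<forall>d\<in>P. 0 < \<mu> d \<and> \<mu> d \<in> \<rat>"
  shows "\<exists>(l::nat) (k::'i \<Rightarrow> nat). 0 < l \<and> (\<forall>d\<in>P. 0 < k d \<and> \<mu> d = of_nat (k d) / of_nat l)"
  using assms
proof (induction P rule: finite_induct)
  case (insert x P)
  then obtain l :: nat and k :: "'i \<Rightarrow> nat"
    where lk: "0 < l" "\<forall>d\<in>P. 0 < k d \<and> \<mu> d = of_nat (k d) / of_nat l"
    by auto
  obtain a b :: nat where ab: "0 < a" "0 < b" "\<mu> x = of_nat a / of_nat b"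
    using pos_rat_as_quotient insert.prems by blast
  show ?case
    using lk ab insert.hyps
    by (intro exI[of _ "l * b"] exI[of _ "\<lambda>d. if d = x then a * l else k d * b"]) auto
qed auto

lemma pos_rat_comb_zero_nat_coeffs:
  fixes V :: "'i \<Rightarrow> ('a::linordered_field)^'n::finite"
  assumes "pos_rat_comb V 0 C \<mu>"
  shows "\<exists>\<alpha> l. 0 < l \<and> pos_dep_coeffs C V \<alpha> \<and> (\<forall>d\<in>C. of_nat (\<alpha> d) = of_nat l * \<mu> d)"
proof -
  obtain l :: nat and k :: "'i \<Rightarrow> nat"
    where lk: "0 < l" "\<forall>d\<in>C. 0 < k d \<and> \<mu> d = of_nat (k d) / of_nat l"
    using common_denominator[of C \<mu>] assms unfolding pos_rat_comb_def by blast
  then have k: "of_nat (k d) = of_nat l * \<mu> d" if "d \<in> C" for d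
    using that by simp
  have "(\<Sum>d\<in>C. of_nat (k d) *s V d) = of_nat l *s (\<Sum>d\<in>C. \<mu> d *s V d)"
    by (simp add: k vec_eq_iff sum_distrib_left mult.assoc)
  also have "\<dots> = 0" using assms by (simp add: pos_rat_comb_def)
  finally have "pos_dep_coeffs C V k" using lk by (auto simp: pos_dep_coeffs_def)
  then show ?thesis using lk(1) k by blast
qed

section \<open>Shrinking the support of a combination\<close>

text \<open>Move from \<open>\<mu>\<close> in direction \<open>\<beta>\<close> until the first
  coefficient vanishes, which happens because \<open>\<beta>\<close> has a negative entry. The
  combined vector is unchanged, and the weight does not grow because its slope is at most 0.\<close>

lemma dependency_reduces_support:
  fixes V :: "'i \<Rightarrow> ('a::linordered_field)^'n::finite" and w :: "'i \<Rightarrow> 'a"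
  assumes \<mu>: "pos_rat_comb V v P \<mu>"
    and rat: "\<forall>d\<in>P. \<beta> d \<in> \<rat>"
    and dep: "(\<Sum>d\<in>P. \<beta> d *s V d) = 0"
    and neg: "\<exists>d\<in>P. \<beta> d < 0"
    and w: "(\<Sum>d\<in>P. \<beta> d * w d) \<le> 0"
  shows "\<exists>P' \<mu>'. P' \<subset> P \<and> pos_rat_comb V v P' \<mu>' \<and> (\<Sum>d\<in>P'. \<mu>' d * w d) \<le> (\<Sum>d\<in>P. \<mu> d * w d)"
proof -
  have fin: "finite P" and pos: "\<And>d. d \<in> P \<Longrightarrow> 0 < \<mu> d" and \<mu>_rat: "\<And>d. d \<in> P \<Longrightarrow> \<mu> d \<in> \<rat>"
    using \<mu> by (auto simp: pos_rat_comb_def)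
  define N where "N = {d \<in> P. \<beta> d < 0}"
  \<comment> \<open>The ratio test: the coefficient of \<open>d\<close> reaches 0 at time
    \<open>r d\<close>, and the minimum \<open>t\<close> is the last moment at which all
    coefficients are nonnegative. It is a quotient of rationals, so the new coefficients stay
    rational.\<close>
  define r where "r = (\<lambda>d. \<mu> d / - \<beta> d)"
  have N: "finite (r ` N)" "r ` N \<noteq> {}" using fin neg by (auto simp: N_def)
  define t where "t = Min (r ` N)"
  obtain e where e: "e \<in> N" "t = r e" using Min_in[OF N] by (auto simp: t_def)
  have t: "0 < t" "t \<in> \<rat>"
    using e pos[of e] \<mu>_rat[of e] rat by (auto simp: N_def r_def divide_pos_neg)
  define \<mu>' where "\<mu>' = (\<lambda>d. \<mu> d + t * \<beta> d)"
  define P' where "P' = {d \<in> P. \<mu>' d \<noteq> 0}"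
  have nonneg: "0 \<le> \<mu>' d" if "d \<in> P" for d
  proof (cases "\<beta> d < 0")
    case True
    then have "t \<le> r d" using that N(1) by (auto simp: t_def N_def)
    then show ?thesis using True by (simp add: r_def \<mu>'_def field_simps)
  next
    case False
    then show ?thesis using pos[OF that] t(1) by (simp add: \<mu>'_def)
  qed
  have "e \<in> P" "\<mu>' e = 0" using e by (auto simp: N_def r_def \<mu>'_def)
  then have psub: "P' \<subset> P" by (auto simp: P'_def)
  have "(\<Sum>d\<in>P'. \<mu>' d *s V d) = (\<Sum>d\<in>P. \<mu>' d *s V d)"
    using fin by (intro sum.mono_neutral_left) (auto simp: P'_def)
  also have "\<dots> = (\<Sum>d\<in>P. \<mu> d *s V d) + t *s (\<Sum>d\<in>P. \<beta> d *s V d)"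
    by (simp add: \<mu>'_def vec_eq_iff algebra_simps sum.distrib sum_distrib_left)
  also have "\<dots> = v" using \<mu> dep by (simp add: pos_rat_comb_def)
  finally have "(\<Sum>d\<in>P'. \<mu>' d *s V d) = v" .
  moreover have "0 < \<mu>' d \<and> \<mu>' d \<in> \<rat>" if "d \<in> P'" for d
  proof -
    have "d \<in> P" "\<mu>' d \<noteq> 0" using that by (auto simp: P'_def)
    then show ?thesis using nonneg[of d] t(2) rat \<mu>_rat[of d] by (auto simp: \<mu>'_def)
  qed
  ultimately have "pos_rat_comb V v P' \<mu>'"
    using fin by (auto simp: pos_rat_comb_def P'_def)
  moreover have "(\<Sum>d\<in>P'. \<mu>' d * w d) = (\<Sum>d\<in>P. \<mu>' d * w d)"
    using fin by (intro sum.mono_neutral_left) (auto simp: P'_def)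
  moreover have "(\<Sum>d\<in>P. \<mu>' d * w d) = (\<Sum>d\<in>P. \<mu> d * w d) + t * (\<Sum>d\<in>P. \<beta> d * w d)"
    by (simp add: \<mu>'_def algebra_simps sum.distrib sum_distrib_left)
  moreover have "t * (\<Sum>d\<in>P. \<beta> d * w d) \<le> 0"
    using t(1) w by (simp add: mult_le_0_iff)
  ultimately show ?thesis using psub by (intro exI[of _ P'] exI[of _ \<mu>']) auto
qed

text \<open>Two combinations on the same support differ by a dependency, and one of its two signs
  does not increase the weight. Moving along it shrinks the support, so the induction ends at a
  support with a single combination.\<close>

lemma dominated_by_unique_combination:
  fixes V :: "'i \<Rightarrow> ('a::archimedean_field)^'n::finite" and w :: "'i \<Rightarrow> 'a"
  assumes "pos_rat_comb V v P \<mu>"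
    and "\<And>P' \<mu>'. P' \<subseteq> P \<Longrightarrow> pos_rat_comb V v P' \<mu>' \<Longrightarrow> m \<le> (\<Sum>d\<in>P'. \<mu>' d * w d)"
  shows "\<exists>P' \<mu>'. P' \<subseteq> P \<and> pos_rat_comb V v P' \<mu>' \<and>
    (\<Sum>d\<in>P'. \<mu>' d * w d) \<le> (\<Sum>d\<in>P. \<mu> d * w d) \<and>
    (\<forall>\<mu>''. pos_rat_comb V v P' \<mu>'' \<longrightarrow> (\<forall>d\<in>P'. \<mu>'' d = \<mu>' d))"
proof -
  have "finite P" using assms(1) by (simp add: pos_rat_comb_def)
  then show ?thesis using assms
  proof (induction P arbitrary: \<mu> rule: finite_psubset_induct)
    case (psubset P)
    show ?case
    proof (cases "\<forall>\<mu>''. pos_rat_comb V v P \<mu>'' \<longrightarrow> (\<forall>d\<in>P. \<mu>'' d = \<mu> d)")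
      case True
      then show ?thesis using psubset.prems(1) by blast
    next
      case False
      then obtain \<mu>'' e where \<mu>'': "pos_rat_comb V v P \<mu>''" and e: "e \<in> P" "\<mu>'' e \<noteq> \<mu> e" by blast
      define \<beta> where "\<beta> = (\<lambda>d. \<mu>'' d - \<mu> d)"
      have \<beta>: "\<forall>d\<in>P. \<beta> d \<in> \<rat>" "(\<Sum>d\<in>P. \<beta> d *s V d) = 0"
        using psubset.prems(1) \<mu>''
        by (auto simp: \<beta>_def pos_rat_comb_def vector_sub_rdistrib sum_subtractf)
      obtain \<gamma> where \<gamma>: "\<forall>d\<in>P. \<gamma> d \<in> \<rat>" "(\<Sum>d\<in>P. \<gamma> d *s V d) = 0" "(\<Sum>d\<in>P. \<gamma> d * w d) \<le> 0"
        "\<gamma> e \<noteq> 0"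
      proof (cases "(\<Sum>d\<in>P. \<beta> d * w d) \<le> 0")
        case True
        then show ?thesis using that[of \<beta>] \<beta> e(2) by (simp add: \<beta>_def)
      next
        case False
        then show ?thesis using that[of "\<lambda>d. - \<beta> d"] \<beta> e(2)
          by (simp add: \<beta>_def sum_negf vector_smult_lneg del: minus_diff_eq)
      qed
      have "\<exists>\<gamma>. (\<forall>d\<in>P. \<gamma> d \<in> \<rat>) \<and> (\<Sum>d\<in>P. \<gamma> d *s V d) = 0 \<and> (\<Sum>d\<in>P. \<gamma> d * w d) \<le> 0 \<and>
        (\<exists>d\<in>P. \<gamma> d < 0)"
      proof (cases "\<exists>d\<in>P. \<gamma> d < 0")
        case False
        then have nonneg: "\<forall>d\<in>P. 0 \<le> \<gamma> d" by force
        \<comment> \<open>A nonnegative dependency may be added any number of times. With negative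
          weight it would, by the Archimedean property, push the combination below
          \<open>m\<close>.\<close>
        have "(\<Sum>d\<in>P. \<gamma> d * w d) = 0"
        proof (rule ccontr)
          assume "(\<Sum>d\<in>P. \<gamma> d * w d) \<noteq> 0"
          with \<gamma>(3) have neg: "0 < - (\<Sum>d\<in>P. \<gamma> d * w d)" by simp
          obtain n :: nat where
            "(\<Sum>d\<in>P. \<mu> d * w d) - m < of_nat n * - (\<Sum>d\<in>P. \<gamma> d * w d)"
            using ex_less_of_nat_mult[OF neg] by blast
          moreover have "(\<Sum>d\<in>P. (\<mu> d + of_nat n * \<gamma> d) * w d) =
            (\<Sum>d\<in>P. \<mu> d * w d) + of_nat n * (\<Sum>d\<in>P. \<gamma> d * w d)"
            by (simp add: distrib_right sum.distrib sum_distrib_left mult.assoc)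
          moreover have "(\<Sum>d\<in>P. (\<mu> d + of_nat n * \<gamma> d) *s V d) =
            (\<Sum>d\<in>P. \<mu> d *s V d) + of_nat n *s (\<Sum>d\<in>P. \<gamma> d *s V d)"
            by (simp add: vec_eq_iff algebra_simps sum.distrib sum_distrib_left)
          then have "pos_rat_comb V v P (\<lambda>d. \<mu> d + of_nat n * \<gamma> d)"
            using psubset.prems(1) \<gamma>(1,2) nonneg
            by (auto simp: pos_rat_comb_def add_pos_nonneg)
          from psubset.prems(2)[OF subset_refl this]
          have "m \<le> (\<Sum>d\<in>P. (\<mu> d + of_nat n * \<gamma> d) * w d)" .
          ultimately show False by simp
        qed
        \<comment> \<open>Since the weight of \<open>\<gamma>\<close> is 0, its negative qualifies
          as well, and that is negative at \<open>e\<close>.\<close>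
        then show ?thesis using \<gamma> e(1) nonneg
          by (intro exI[of _ "\<lambda>d. - \<gamma> d"])
            (auto simp: sum_negf vector_smult_lneg intro!: bexI[of _ e] order.not_eq_order_implies_strict)
      qed (use \<gamma> in blast)
      then obtain \<gamma> where "\<forall>d\<in>P. \<gamma> d \<in> \<rat>" "(\<Sum>d\<in>P. \<gamma> d *s V d) = 0"
        "(\<Sum>d\<in>P. \<gamma> d * w d) \<le> 0" "\<exists>d\<in>P. \<gamma> d < 0"
        by blast
      from dependency_reduces_support[OF psubset.prems(1) this(1,2,4,3)]
      obtain P' \<mu>' where P': "P' \<subset> P" "pos_rat_comb V v P' \<mu>'"
        "(\<Sum>d\<in>P'. \<mu>' d * w d) \<le> (\<Sum>d\<in>P. \<mu> d * w d)"
        by blast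
      have "m \<le> (\<Sum>d\<in>Q. \<mu>' d * w d)" if "Q \<subseteq> P'" "pos_rat_comb V v Q \<mu>'" for Q \<mu>'
        using psubset.prems(2) that P'(1) by blast
      from psubset.IH[OF P'(1,2) this] show ?thesis
        using P'(1,3) by (meson order_trans psubset_imp_subset)
    qed
  qed
qed

text \<open>Take a negative combination whose support is minimal. A failure of simplicity, either a
  repeated vector or a positively dependent proper subfamily, yields a dependency that shrinks the
  support while the weight stays negative.\<close>

lemma negative_combination_contains_simple:
  fixes V :: "'i \<Rightarrow> ('a::linordered_field)^'n::finite" and w :: "'i \<Rightarrow> 'a"
  assumes "pos_rat_comb V 0 C \<mu>" and "(\<Sum>d\<in>C. \<mu> d * w d) < 0" and "\<forall>d\<in>C. V d \<noteq> 0"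
  shows "\<exists>C' \<mu>'. C' \<subseteq> C \<and> simple_positively_dependent C' V \<and> pos_rat_comb V 0 C' \<mu>' \<and>
    (\<Sum>d\<in>C'. \<mu>' d * w d) < 0"
proof -
  have "finite C" using assms(1) by (simp add: pos_rat_comb_def)
  then show ?thesis using assms
  proof (induction C arbitrary: \<mu> rule: finite_psubset_induct)
    case (psubset C)
    show ?case
    proof (cases "\<exists>C' \<mu>'. C' \<subset> C \<and> pos_rat_comb V 0 C' \<mu>' \<and> (\<Sum>d\<in>C'. \<mu>' d * w d) < 0")
      case True
      then obtain C' \<mu>' where C': "C' \<subset> C" "pos_rat_comb V 0 C' \<mu>'" "(\<Sum>d\<in>C'. \<mu>' d * w d) < 0"
        by blast
      from psubset.IH[OF this] show ?thesis using C'(1) psubset.prems(3)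
        by (meson order_trans psubset_imp_subset subsetD)
    next
      case minimal: False
      have no_dep: False
        if "\<forall>d\<in>C. \<beta> d \<in> \<rat>" "(\<Sum>d\<in>C. \<beta> d *s V d) = 0" "\<exists>d\<in>C. \<beta> d < 0" "(\<Sum>d\<in>C. \<beta> d * w d) \<le> 0"
        for \<beta>
        using dependency_reduces_support[OF psubset.prems(1) that] psubset.prems(2) minimal
        by (meson le_less_trans)
      have "inj_on V C"
      proof (rule ccontr)
        assume "\<not> inj_on V C"
        then obtain c c' where "c \<in> C" "c' \<in> C" "c \<noteq> c'" "V c = V c'" "w c \<le> w c'"
          by (metis inj_onI linear)
        note cc = this
        \<comment> \<open>Shifts coefficient from \<open>c'\<close> to \<open>c\<close>, which has
          the same vector and no larger weight.\<close>
        define \<beta> :: "'i \<Rightarrow> 'a" where "\<beta> = (\<lambda>d. if d = c then 1 else if d = c' then - 1 else 0)"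
        have "(\<Sum>d\<in>C. \<beta> d *s V d) = (\<Sum>d\<in>{c, c'}. \<beta> d *s V d)"
          using cc psubset.hyps by (intro sum.mono_neutral_right) (auto simp: \<beta>_def)
        moreover have "(\<Sum>d\<in>C. \<beta> d * w d) = (\<Sum>d\<in>{c, c'}. \<beta> d * w d)"
          using cc psubset.hyps by (intro sum.mono_neutral_right) (auto simp: \<beta>_def)
        ultimately show False
          using cc by (intro no_dep[of \<beta>]) (auto simp: \<beta>_def vector_smult_lneg)
      qed
      moreover have "C \<noteq> {}" using psubset.prems(2) by auto
      moreover have "\<exists>\<alpha>. pos_dep_coeffs C V \<alpha>"
        using pos_rat_comb_zero_nat_coeffs[OF psubset.prems(1)] by blast
      moreover have "\<not> positively_dependent J V" if J: "J \<subset> C" "J \<noteq> {}" for J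
      proof
        assume "positively_dependent J V"
        then obtain \<alpha> where \<alpha>: "\<forall>d\<in>J. 0 < \<alpha> d" "(\<Sum>d\<in>J. of_nat (\<alpha> d) *s V d) = 0" and "finite J"
          by (auto simp: positively_dependent_def pos_dep_coeffs_def)
        then have "pos_rat_comb V 0 J (\<lambda>d. of_nat (\<alpha> d))" by (auto simp: pos_rat_comb_def)
        with minimal J have w: "0 \<le> (\<Sum>d\<in>J. of_nat (\<alpha> d) * w d)" by (meson not_le)
        \<comment> \<open>By minimality the combination on \<open>J\<close> has nonnegative weight,
          so subtracting it cannot increase the weight.\<close>
        define \<beta> :: "'i \<Rightarrow> 'a" where "\<beta> = (\<lambda>d. if d \<in> J then - of_nat (\<alpha> d) else 0)"
        have "(\<Sum>d\<in>C. \<beta> d *s V d) = (\<Sum>d\<in>J. - (of_nat (\<alpha> d) *s V d))"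
          using J psubset.hyps
          by (intro sum.mono_neutral_cong_right) (auto simp: \<beta>_def vector_smult_lneg)
        moreover have "(\<Sum>d\<in>C. \<beta> d * w d) = (\<Sum>d\<in>J. - (of_nat (\<alpha> d) * w d))"
          using J psubset.hyps by (intro sum.mono_neutral_cong_right) (auto simp: \<beta>_def)
        moreover have "\<exists>d\<in>C. \<beta> d < 0" using J \<alpha>(1) by (force simp: \<beta>_def)
        ultimately show False
          using \<alpha>(2) w by (intro no_dep[of \<beta>]) (auto simp: sum_negf \<beta>_def)
      qed
      ultimately have "simple_positively_dependent C V"
        using psubset by (auto simp: simple_positively_dependent_def positively_dependent_def)
      then show ?thesis using psubset.prems by blast
    qed
  qed
qed


section \<open>Weights of hyperpaths\<close>

lemma sum_mono_extended:
  fixes f g :: "'i \<Rightarrow> 'a::linordered_field extended"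
  assumes "\<And>d. d \<in> A \<Longrightarrow> f d \<le> g d"
  shows "sum f A \<le> sum g A"
  using assms by (induction A rule: infinite_finite_induct) (auto intro: add_mono)

lemma sum_Fin: "(\<Sum>d\<in>A. Fin (f d)) = Fin (\<Sum>d\<in>A. f d :: 'a::linordered_field)"
  by (induction A rule: infinite_finite_induct) (auto simp: zero_extended_def)

lemma sum_Pinf:
  fixes f :: "'i \<Rightarrow> 'a::linordered_field extended"
  assumes "finite A" and "d \<in> A" and "f d = \<infinity>"
  shows "sum f A = \<infinity>"
proof -
  \<comment> \<open>\<open>\<infinity>\<close> absorbs even \<open>-\<infinity>\<close>, so a single
    infinite term determines the sum.\<close>
  have "\<infinity> + x = \<infinity>" for x :: "'a extended" by (cases x) auto
  then show ?thesis using assms by (simp add: sum.remove)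
qed

lemma map_extended_mult_mono:
  fixes x y :: "'a::linordered_field extended"
  assumes "x \<le> y" and "0 \<le> a"
  shows "map_extended ((*) a) x \<le> map_extended ((*) a) y"
  using assms by (cases x; cases y) (auto simp: mult_left_mono)

lemma weighted_sum_ge:
  assumes "\<And>d. d \<in> P \<Longrightarrow> 0 \<le> \<mu> d" and "\<And>d. d \<in> P \<Longrightarrow> Fin (g d) \<le> w d"
  shows "Fin (\<Sum>d\<in>P. \<mu> d * g d) \<le> weighted_sum w (P, \<mu>)"
  unfolding weighted_sum_def prod.case sum_Fin[symmetric]
  using assms map_extended_mult_mono[of "Fin _"] by (intro sum_mono_extended) fastforce

lemma weighted_sum_le:
  assumes "\<And>d. d \<in> P \<Longrightarrow> 0 \<le> \<mu> d" and "\<And>d. d \<in> P \<Longrightarrow> w d \<le> Fin (g d)"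
  shows "weighted_sum w (P, \<mu>) \<le> Fin (\<Sum>d\<in>P. \<mu> d * g d)"
  unfolding weighted_sum_def prod.case sum_Fin[symmetric]
  using assms map_extended_mult_mono[of _ "Fin _"] by (intro sum_mono_extended) fastforce

lemma weighted_sum_weight_subset:
  assumes "P \<subseteq> S"
  shows "weighted_sum (weight S) (P, \<mu>) = Fin (\<Sum>d\<in>P. \<mu> d * bound d)"
proof -
  have "(\<Sum>d\<in>P. map_extended ((*) (\<mu> d)) (weight S d)) = (\<Sum>d\<in>P. Fin (\<mu> d * bound d))"
    using assms by (intro sum.cong) (auto simp: weight_def)
  then show ?thesis by (simp add: weighted_sum_def sum_Fin)
qed

text \<open>Hyperpaths that leave \<open>S\<close> cannot lower the minimum, which confines the
  search to the finitely many subsets of \<open>S\<close>.\<close>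

lemma weighted_sum_weight_not_subset:
  assumes "finite P" and "\<not> P \<subseteq> S"
  shows "weighted_sum (weight S) (P, \<mu>) = \<infinity>"
proof -
  obtain d where "d \<in> P" "d \<notin> S" using assms(2) by blast
  then show ?thesis
    using assms(1) by (auto simp: weighted_sum_def weight_def intro!: sum_Pinf[of _ d])
qed

section \<open>Constraints as linear inequalities\<close>

lemma dot_basis_vec: "dot (basis_vec i) \<nu> = valuation_at \<nu> i"
  by (cases i) (auto simp: dot_axis_left)

lemma satisfies_iff_dot: "satisfies \<nu> c \<longleftrightarrow> dot (normal c) \<nu> \<le> bound c"
  by (cases c) (simp add: dot_add_left dot_diff_left dot_basis_vec algebra_simps)

lemma basis_vec_integral: "basis_vec i $ k \<in> \<int>"
  by (cases i) (auto simp: axis_def)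

lemma normal_integral: "normal c $ k \<in> \<int>"
  by (cases c) (auto intro!: Ints_add Ints_diff basis_vec_integral)

lemma complement_normal_eq: "complement_normal c = - normal c"
  by (cases c) simp

text \<open>The complement has normal \<open>- normal c\<close>, so a hyperpath writes
  \<open>normal c\<close> as a combination of other normals. On a finite set, a common denominator
  exists exactly when all coefficients are positive rationals.\<close>

lemma hyperpaths_iff:
  "(P, \<mu>) \<in> hyperpaths c \<longleftrightarrow>
     P \<noteq> {} \<and> inj_on normal P \<and> (\<forall>d\<in>P. normal d \<noteq> 0) \<and> pos_rat_comb normal (normal c) P \<mu>"
proof -
  have "(\<exists>(l::nat) (k::_ \<Rightarrow> nat). 0 < l \<and> (\<forall>d\<in>P. 0 < k d \<and> \<mu> d = of_nat (k d) / of_nat l)) \<longleftrightarrow>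
    (\<forall>d\<in>P. 0 < \<mu> d \<and> \<mu> d \<in> \<rat>)" if "finite P"
    using common_denominator[OF that] by fastforce
  then show ?thesis
    by (auto simp: hyperpaths_def pos_rat_comb_def complement_normal_eq neg_eq_iff_add_eq_0[symmetric])
qed

lemma self_hyperpath:
  assumes "normal c \<noteq> 0"
  shows "({c}, \<lambda>_. 1) \<in> hyperpaths c"
  using assms by (simp add: hyperpaths_iff pos_rat_comb_def)

section \<open>Attainment of the minimum weight\<close>

text \<open>There are infinitely many hyperpaths, but each one inside \<open>S\<close> is dominated
  by one whose support carries a single combination. Such supports give only finitely many values,
  and the smallest of them is the minimum.\<close>

lemma min_weight_attained:
  fixes S :: "('a::archimedean_field, 'n::finite) constraint4 set"
  assumes "finite S" and "c \<in> S" and "normal c \<noteq> 0"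
    and bounded: "\<And>h. h \<in> hyperpaths c \<Longrightarrow> Fin m \<le> weighted_sum (weight S) h"
  shows "\<exists>h\<in>hyperpaths c. min_weight S c = weighted_sum (weight S) h"
    and "h \<in> hyperpaths c \<Longrightarrow> min_weight S c \<le> weighted_sum (weight S) h"
proof -
  define W where "W = weighted_sum (weight S) ` hyperpaths c"
  define val where "val = (\<lambda>P (\<mu> :: ('a, 'n) constraint4 \<Rightarrow> 'a). \<Sum>d\<in>P. \<mu> d * bound d)"
  define uniq where "uniq P \<mu> \<longleftrightarrow> P \<subseteq> S \<and> (P, \<mu>) \<in> hyperpaths c \<and>
    (\<forall>\<mu>'. pos_rat_comb normal (normal c) P \<mu>' \<longrightarrow> (\<forall>d\<in>P. \<mu>' d = \<mu> d))" for P \<mu>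
  define U where "U = {val P \<mu> | P \<mu>. uniq P \<mu>}"
  \<comment> \<open>Uniqueness makes the value a function of the support, so any choice of
    coefficients gives the same one.\<close>
  have "U \<subseteq> (\<lambda>P. val P (SOME \<mu>. uniq P \<mu>)) ` Pow S"
  proof
    fix x assume "x \<in> U"
    then obtain P \<mu> where P: "x = val P \<mu>" "uniq P \<mu>" by (auto simp: U_def)
    have "uniq P (SOME \<mu>. uniq P \<mu>)" using someI[of "uniq P", OF P(2)] .
    then have "pos_rat_comb normal (normal c) P (SOME \<mu>. uniq P \<mu>)"
      unfolding uniq_def[of P "SOME \<mu>. uniq P \<mu>"] by (simp only: hyperpaths_iff)
    then have "\<forall>d\<in>P. (SOME \<mu>. uniq P \<mu>) d = \<mu> d"
      using P(2) unfolding uniq_def[of P \<mu>] by blast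
    then have "x = val P (SOME \<mu>. uniq P \<mu>)" by (simp add: P(1) val_def)
    then show "x \<in> (\<lambda>P. val P (SOME \<mu>. uniq P \<mu>)) ` Pow S" using P(2) by (auto simp: uniq_def)
  qed
  then have "finite U" using assms(1) by (meson finite_Pow_iff finite_imageI finite_subset)
  have U_W: "Fin u \<in> W" if u: "u \<in> U" for u
  proof -
    obtain P \<mu> where P: "u = val P \<mu>" "P \<subseteq> S" "(P, \<mu>) \<in> hyperpaths c"
      using u by (auto simp: U_def uniq_def)
    then have "Fin u = weighted_sum (weight S) (P, \<mu>)"
      by (simp add: val_def weighted_sum_weight_subset)
    then show ?thesis unfolding W_def using P(3) by (rule image_eqI)
  qed
  have below: "\<exists>u\<in>U. u \<le> val P \<mu>" if P: "P \<subseteq> S" "(P, \<mu>) \<in> hyperpaths c" for P \<mu>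
  proof -
    have P2: "inj_on normal P" "\<forall>d\<in>P. normal d \<noteq> 0" "pos_rat_comb normal (normal c) P \<mu>"
      using P(2) unfolding hyperpaths_iff by blast+
    \<comment> \<open>Smaller supports inherit distinct and nonzero normals, and are nonempty
      because an empty sum cannot equal the nonzero \<open>normal c\<close>.\<close>
    have sub: "(Q, \<mu>') \<in> hyperpaths c" if "Q \<subseteq> P" "pos_rat_comb normal (normal c) Q \<mu>'" for Q \<mu>'
    proof -
      have "Q \<noteq> {}" using that(2) assms(3) by (auto simp: pos_rat_comb_def)
      then show ?thesis unfolding hyperpaths_iff
        using that P2(1,2) inj_on_subset[OF P2(1) that(1)] by blast
    qed
    have "m \<le> (\<Sum>d\<in>Q. \<mu>' d * bound d)" if "Q \<subseteq> P" "pos_rat_comb normal (normal c) Q \<mu>'" for Q \<mu>'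
      using bounded[OF sub[OF that]] that(1) P(1)
      by (simp add: weighted_sum_weight_subset subset_trans[of Q P S])
    from dominated_by_unique_combination[OF P2(3) this]
    obtain Q \<mu>' where Q: "Q \<subseteq> P" "pos_rat_comb normal (normal c) Q \<mu>'" "val Q \<mu>' \<le> val P \<mu>"
      "\<forall>\<mu>''. pos_rat_comb normal (normal c) Q \<mu>'' \<longrightarrow> (\<forall>d\<in>Q. \<mu>'' d = \<mu>' d)"
      unfolding val_def by blast
    then have "val Q \<mu>' \<in> U" using sub[OF Q(1,2)] Q(1,4) P(1) unfolding U_def uniq_def by blast
    then show ?thesis using Q(3) by blast
  qed
  have "U \<noteq> {}" using below[of "{c}"] self_hyperpath[OF assms(3)] assms(2) by auto
  define u where "u = Min U"
  have u: "u \<in> U" "\<And>x. x \<in> U \<Longrightarrow> u \<le> x"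
    using \<open>finite U\<close> \<open>U \<noteq> {}\<close> by (auto simp: u_def)
  have least: "Fin u \<le> x" if x: "x \<in> W" for x
  proof -
    obtain P \<mu> where P: "(P, \<mu>) \<in> hyperpaths c" "x = weighted_sum (weight S) (P, \<mu>)"
      using x by (auto simp: W_def)
    show ?thesis
    proof (cases "P \<subseteq> S")
      case True
      from below[OF True P(1)] obtain u' where "u' \<in> U" "u' \<le> val P \<mu>" by blast
      then show ?thesis using u(2)[of u'] True P(2)
        by (simp add: weighted_sum_weight_subset val_def)
    next
      case False
      then show ?thesis using P
        by (simp add: weighted_sum_weight_not_subset hyperpaths_iff pos_rat_comb_def)
    qed
  qed
  have "(LEAST x. x \<in> W) = Fin u"
    using U_W[OF u(1)] least by (intro Least_equality) auto
  moreover have "\<exists>m. \<forall>x\<in>W. Fin m \<le> x" using least by blast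
  ultimately have min: "min_weight S c = Fin u" by (simp add: min_weight_def W_def)
  show "\<exists>h\<in>hyperpaths c. min_weight S c = weighted_sum (weight S) h"
    using U_W[OF u(1)] min by (auto simp: W_def)
  show "h \<in> hyperpaths c \<Longrightarrow> min_weight S c \<le> weighted_sum (weight S) h"
    using least min by (auto simp: W_def)
qed

text \<open>If the weights are bounded below, \<open>c\<close> is a hyperpath of itself and its
  bound takes part in the minimum; otherwise the minimum weight is
  \<open>-\<infinity>\<close>.\<close>

lemma min_weight_le_bound:
  fixes S :: "('a::archimedean_field, 'n::finite) constraint4 set"
  assumes "finite S" and "c \<in> S" and "normal c \<noteq> 0"
  shows "min_weight S c \<le> Fin (bound c)"
proof (cases "\<exists>m. \<forall>h\<in>hyperpaths c. Fin m \<le> weighted_sum (weight S) h")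
  case True
  then obtain m where "\<And>h. h \<in> hyperpaths c \<Longrightarrow> Fin m \<le> weighted_sum (weight S) h" by blast
  from min_weight_attained(2)[OF assms this self_hyperpath[OF assms(3)]]
  show ?thesis using assms(2) by (simp add: weighted_sum_weight_subset)
next
  case False
  then have "min_weight S c = -\<infinity>" unfolding min_weight_def Let_def by (auto simp del: not_all)
  then show ?thesis by simp
qed

text \<open>Expanding \<open>normal c\<close> along a hyperpath bounds each weight from below.
  Attainment carries this over to \<open>min_weight\<close>, whose value is then the weight of an
  actual hyperpath.\<close>

lemma min_weight_ge_dot:
  fixes S :: "('a::archimedean_field, 'n::finite) constraint4 set"
  assumes "finite S" and "c \<in> S" and "normal c \<noteq> 0" and "\<nu> \<in> solutions S"
  shows "Fin (dot (normal c) \<nu>) \<le> min_weight S c"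
proof -
  have bounded: "Fin (dot (normal c) \<nu>) \<le> weighted_sum (weight S) h" if "h \<in> hyperpaths c" for h
  proof -
    obtain P \<mu> where h: "h = (P, \<mu>)" by (cases h)
    have \<mu>: "pos_rat_comb normal (normal c) P \<mu>" using that by (simp add: h hyperpaths_iff)
    then have "normal c = (\<Sum>d\<in>P. \<mu> d *s normal d)" by (simp add: pos_rat_comb_def)
    then have "dot (normal c) \<nu> = (\<Sum>d\<in>P. \<mu> d * dot (normal d) \<nu>)"
      by (simp add: dot_sum_left dot_scale_left)
    moreover have "Fin (dot (normal d) \<nu>) \<le> weight S d" for d
      using assms(4) by (auto simp: weight_def solutions_def satisfies_iff_dot)
    ultimately show ?thesis
      using weighted_sum_ge[of P \<mu> "\<lambda>d. dot (normal d) \<nu>" "weight S"] \<mu>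
      by (auto simp: h pos_rat_comb_def less_imp_le)
  qed
  then show ?thesis using min_weight_attained(1)[OF assms(1-3)] by metis
qed


section \<open>Solutions and simple hypercycles\<close>

text \<open>Summing the lower bounds along the cycle gives the scalar product of the zero vector
  with \<open>\<nu>\<close>. Constraints outside \<open>S\<close> have weight
  \<open>\<infinity>\<close> and satisfy the bound trivially.\<close>

lemma solution_imp_positive_hypercycle:
  fixes S :: "('a::archimedean_field, 'n::finite) constraint4 set"
  assumes "finite S" and "\<nu> \<in> solutions S" and "simple_hypercycle C \<alpha>"
  shows "positive_hypercycle (min_hypergraph S) C \<alpha>"
proof -
  have "\<forall>c\<in>C. normal c \<noteq> 0" and cycle: "(\<Sum>c\<in>C. of_nat (\<alpha> c) *s normal c) = 0"
    using assms(3) by (auto simp: simple_hypercycle_def simple_positively_dependent_def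
        positively_dependent_def pos_dep_coeffs_def)
  then have "Fin (dot (normal c) \<nu>) \<le> min_hypergraph S c" if "c \<in> C" for c
    using min_weight_ge_dot[OF assms(1) _ _ assms(2)] that by (simp add: min_hypergraph_def)
  then have "Fin (\<Sum>c\<in>C. of_nat (\<alpha> c) * dot (normal c) \<nu>) \<le>
    weighted_sum (min_hypergraph S) (C, \<lambda>c. of_nat (\<alpha> c))"
    by (intro weighted_sum_ge) auto
  moreover have "(\<Sum>c\<in>C. of_nat (\<alpha> c) * dot (normal c) \<nu>) = 0"
    using arg_cong[OF cycle, of "\<lambda>v. dot v \<nu>"] by (simp add: dot_sum_left dot_scale_left)
  ultimately show ?thesis by (simp add: positive_hypercycle_def zero_extended_def)
qed

lemma unsolvable_imp_negative_combination:
  fixes S :: "('a::linordered_field, 'n::finite) constraint4 set"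
  assumes "finite S" and "\<forall>c\<in>S. normal c = 0 \<longrightarrow> 0 \<le> bound c" and "solutions S = {}"
  shows "\<exists>C \<mu>. C \<subseteq> S \<and> (\<forall>c\<in>C. normal c \<noteq> 0) \<and> pos_rat_comb normal 0 C \<mu> \<and>
    (\<Sum>c\<in>C. \<mu> c * bound c) < 0"
proof -
  have "\<nexists>x. \<forall>(a, b)\<in>(\<lambda>c. (normal c, bound c)) ` S. dot a x \<le> b"
    using assms(3) by (simp add: solutions_def satisfies_iff_dot)
  moreover have "a $ i \<in> \<int>" if "(a, b) \<in> (\<lambda>c. (normal c, bound c)) ` S" for a b i
    using that by (auto simp: normal_integral)
  ultimately obtain \<beta> where \<beta>: "\<beta> < 0" "(0, \<beta>) \<in> nat_cone ((\<lambda>c. (normal c, bound c)) ` S)"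
    using integral_farkas[of "(\<lambda>c. (normal c, bound c)) ` S"] assms(1) by blast
  then obtain \<alpha> :: "_ \<Rightarrow> nat" where \<alpha>:
    "(\<Sum>c\<in>S. of_nat (\<alpha> c) *s normal c) = 0" "(\<Sum>c\<in>S. of_nat (\<alpha> c) * bound c) < 0"
    using nat_cone_image_coeffs[OF assms(1) \<beta>(2)] by auto
  \<comment> \<open>Dropping constraints with zero normal keeps the vector sum and can only lower
    the weight, since their bounds are nonnegative. Dropping zero coefficients makes the rest
    positive.\<close>
  define C where "C = {c \<in> S. normal c \<noteq> 0 \<and> 0 < \<alpha> c}"
  have "(\<Sum>c\<in>C. of_nat (\<alpha> c) *s normal c) = (\<Sum>c\<in>S. of_nat (\<alpha> c) *s normal c)"
    using assms(1) by (intro sum.mono_neutral_left) (auto simp: C_def)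
  then have "pos_rat_comb normal 0 C (\<lambda>c. of_nat (\<alpha> c))"
    using \<alpha>(1) assms(1) by (auto simp: pos_rat_comb_def C_def)
  moreover have "(\<Sum>c\<in>C. of_nat (\<alpha> c) * bound c) \<le> (\<Sum>c\<in>S. of_nat (\<alpha> c) * bound c)"
    using assms(1,2) by (intro sum_mono2) (auto simp: C_def)
  ultimately show ?thesis
    using \<alpha>(2) by (intro exI[of _ C] exI[of _ "\<lambda>c. of_nat (\<alpha> c)"]) (auto simp: C_def)
qed

lemma positive_hypercycles_imp_solvable:
  fixes S :: "('a::archimedean_field, 'n::finite) constraint4 set"
  assumes "finite S" and "\<forall>c\<in>S. normal c = 0 \<longrightarrow> 0 \<le> bound c"
    and positive: "\<And>C \<alpha>. simple_hypercycle C \<alpha> \<Longrightarrow> positive_hypercycle (min_hypergraph S) C \<alpha>"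
  shows "solutions S \<noteq> {}"
proof
  assume "solutions S = {}"
  from unsolvable_imp_negative_combination[OF assms(1,2) this]
  obtain D \<nu> where D: "D \<subseteq> S" "\<forall>c\<in>D. normal c \<noteq> 0" "pos_rat_comb normal 0 D \<nu>"
    "(\<Sum>c\<in>D. \<nu> c * bound c) < 0"
    by blast
  from negative_combination_contains_simple[OF D(3,4,2)]
  obtain C \<mu> where C: "C \<subseteq> D" "simple_positively_dependent C normal" "pos_rat_comb normal 0 C \<mu>"
    "(\<Sum>c\<in>C. \<mu> c * bound c) < 0"
    by blast
  \<comment> \<open>Clearing denominators multiplies the weight by the positive number
    \<open>l\<close> and so preserves its sign.\<close>
  obtain \<alpha> l where \<alpha>: "0 < l" "pos_dep_coeffs C normal \<alpha>" "\<forall>c\<in>C. of_nat (\<alpha> c) = of_nat l * \<mu> c"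
    using pos_rat_comb_zero_nat_coeffs[OF C(3)] by blast
  have "min_hypergraph S c \<le> Fin (bound c)" if "c \<in> C" for c
    using that C(1) D(1,2) min_weight_le_bound[OF assms(1), of c]
    by (auto simp: min_hypergraph_def)
  then have "weighted_sum (min_hypergraph S) (C, \<lambda>c. of_nat (\<alpha> c)) \<le>
    Fin (\<Sum>c\<in>C. of_nat (\<alpha> c) * bound c)"
    by (intro weighted_sum_le) auto
  moreover have "(\<Sum>c\<in>C. of_nat (\<alpha> c) * bound c) = of_nat l * (\<Sum>c\<in>C. \<mu> c * bound c)"
    using \<alpha>(3) by (simp add: sum_distrib_left mult.assoc)
  moreover have "\<dots> < 0" using \<alpha>(1) C(4) by (simp add: mult_pos_neg)
  moreover have "positive_hypercycle (min_hypergraph S) C \<alpha>"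
    using positive C(2) \<alpha>(2) by (simp add: simple_hypercycle_def)
  ultimately have "(0 :: 'a extended) \<le> Fin (of_nat l * (\<Sum>c\<in>C. \<mu> c * bound c))"
    by (auto simp: positive_hypercycle_def intro: order_trans)
  with \<open>of_nat l * (\<Sum>c\<in>C. \<mu> c * bound c) < 0\<close> show False
    by (simp add: zero_extended_def)
qed

text \<open>Archimedean fields cover the reals and the rationals at once.\<close>

theorem solvable_iff_positive_hypercycles:
  fixes S :: "('a::archimedean_field, 'n::finite) constraint4 set"
  assumes "finite S" and "\<forall>c\<in>S. normal c = 0 \<longrightarrow> 0 \<le> bound c"
  shows "solutions S \<noteq> {} \<longleftrightarrow>
    (\<forall>C \<alpha>. simple_hypercycle C \<alpha> \<longrightarrow> positive_hypercycle (min_hypergraph S) C \<alpha>)"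
proof
  assume "solutions S \<noteq> {}"
  then show "\<forall>C \<alpha>. simple_hypercycle C \<alpha> \<longrightarrow> positive_hypercycle (min_hypergraph S) C \<alpha>"
    using solution_imp_positive_hypercycle[OF assms(1)] by fast
next
  assume "\<forall>C \<alpha>. simple_hypercycle C \<alpha> \<longrightarrow> positive_hypercycle (min_hypergraph S) C \<alpha>"
  then show "solutions S \<noteq> {}"
    using positive_hypercycles_imp_solvable[OF assms] by simp
qed

theorem theorem6:
  shows "(\<forall>S :: (real, 'n::finite) constraint4 set.
            finite S \<longrightarrow> bounded_csp S \<longrightarrow>
            (\<forall>c\<in>S. normal c = 0 \<longrightarrow> 0 \<le> bound c) \<longrightarrow>
            (solutions S \<noteq> {} \<longleftrightarrow>
              (\<forall>C \<alpha>. simple_hypercycle C \<alpha> \<longrightarrow> positive_hypercycle (min_hypergraph S) C \<alpha>)))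
       \<and> (\<forall>S :: (rat, 'n) constraint4 set.
            finite S \<longrightarrow> bounded_csp S \<longrightarrow>
            (\<forall>c\<in>S. normal c = 0 \<longrightarrow> 0 \<le> bound c) \<longrightarrow>
            (solutions S \<noteq> {} \<longleftrightarrow>
              (\<forall>C \<alpha>. simple_hypercycle C \<alpha> \<longrightarrow> positive_hypercycle (min_hypergraph S) C \<alpha>)))"
proof (intro conjI allI impI)
  fix S :: "(real, 'n) constraint4 set"
  assume "finite S" "\<forall>c\<in>S. normal c = 0 \<longrightarrow> 0 \<le> bound c"
  then show "solutions S \<noteq> {} \<longleftrightarrow>
      (\<forall>C \<alpha>. simple_hypercycle C \<alpha> \<longrightarrow> positive_hypercycle (min_hypergraph S) C \<alpha>)"
    by (rule solvable_iff_positive_hypercycles)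
next
  fix S :: "(rat, 'n) constraint4 set"
  assume "finite S" "\<forall>c\<in>S. normal c = 0 \<longrightarrow> 0 \<le> bound c"
  then show "solutions S \<noteq> {} \<longleftrightarrow>
      (\<forall>C \<alpha>. simple_hypercycle C \<alpha> \<longrightarrow> positive_hypercycle (min_hypergraph S) C \<alpha>)"
    by (rule solvable_iff_positive_hypercycles)
qed

end
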